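(* Let $x^\ast$ be a local minimum of the MPVC satisfying MPVC-generalized quasinormality. Then $x^\ast$ is an enhanced M-stationary point of the MPVC.
   Context: The mathematical program with vanishing constraints (MPVC) is: minimize $f(x)$ over $x\in\mathbb{R}^n$ subject to $g_i(x)\le 0$ ($i=1,\dots,m$), $h_i(x)=0$ ($i=1,\dots,p$), $H_i(x)\ge 0$ and $G_i(x)H_i(x)\le 0$ ($i=1,\dots,q$), where all functions $f,g_i,h_i,G_i,H_i:\mathbb{R}^n\to\mathbb{R}$ are continuously differentiable. Let $\mathcal{C}$ be its feasible set. For $x^\ast\in\mathcal{C}$ put $I_g=\{i: g_i(x^\ast)=0\}$, $I_+=\{i:H_i(x^\ast)>0\}$, $I_{+0}=\{i:H_i(x^\ast)>0,G_i(x^\ast)=0\}$, $I_{+-}=\{i:H_i(x^\ast)>0,G_i(x^\ast)<0\}$, $I_{00}=\{i:H_i(x^\ast)=0,G_i(x^\ast)=0\}$, $I_{0+}=\{i:H_i(x^\ast)=0,G_i(x^\ast)>0\}$, $I_{0-}=\{i:H_i(x^\ast)=0,G_i(x^\ast)<0\}$. A vector $(\lambda,\mu,\eta^G,\eta^H)\in\mathbb{R}^m\times\mathbb{R}^p\times\mathbb{R}^q\times\mathbb{R}^q$ satisfies the M-sign conditions at $x^\ast$ if: $\lambda_i\ge0$ for $i\in I_g$, $\lambda_i=0$ for $i\notin I_g$; $\eta_i^G=0$ for $i\in I_{+-}\cup I_{0-}\cup I_{0+}$, $\eta_i^G\ge0$ for $i\in I_{+0}\cup I_{00}$; $\eta_i^H=0$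 for $i\in I_+$, $\eta_i^H\ge0$ for $i\in I_{0-}$, $\eta_i^H$ free for $i\in I_{0+}$; $\eta_i^H\eta_i^G=0$ for $i\in I_{00}$. It satisfies the quasinormality sequence condition at $x^\ast$ if there is a sequence $x^k\to x^\ast$ in $\mathbb{R}^n$ such that for all $k\in\mathbb{N}$: $\lambda_i>0\Rightarrow\lambda_ig_i(x^k)>0$ ($i=1,\dots,m$); $\mu_i\ne0\Rightarrow\mu_ih_i(x^k)>0$ ($i=1,\dots,p$); $\eta_i^H\ne0\Rightarrow\eta_i^HH_i(x^k)<0$ ($i=1,\dots,q$); $\eta_i^G>0\Rightarrow\eta_i^GG_i(x^k)>0$ ($i=1,\dots,q$). $x^\ast\in\mathcal{C}$ satisfies MPVC-generalized quasinormality if there is no nonzero $(\lambda,\mu,\eta^G,\eta^H)$ such that $\sum_{i=1}^m\lambda_i\nabla g_i(x^\ast)+\sum_{i=1}^p\mu_i\nabla h_i(x^\ast)+\sum_{i=1}^q\eta_i^G\nabla G_i(x^\ast)-\sum_{i=1}^q\eta_i^H\nabla H_i(x^\ast)=0$ and both the M-sign conditions and the quasinormality sequence condition hold at $x^\ast$. $x^\ast\in\mathcal{C}$ is enhanced M-stationary if there is $(\lambda,\mu,\eta^G,\eta^H)$ satisfying the M-sign conditions at $x^\ast$ with $\nabla f(x^\ast)+\sum_{i=1}^m\lambda_i\nabla g_i(x^\ast)+\sum_{i=1}^p\mu_i\nabla h_i(x^\ast)+\sum_{i=1}^q\eta_i^G\nabla G_i(x^\ast)-\sum_{i=1}^q\eta_i^H\nabla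 H_i(x^\ast)=0$ and such that, if $\lambda,\mu,\eta^G,\eta^H$ are not all equal to zero, the quasinormality sequence condition holds at $x^\ast$. *)

theory Defs
  imports "HOL-Analysis.Analysis"
begin

definition gradient :: "('a::real_inner \<Rightarrow> real) \<Rightarrow> 'a \<Rightarrow> 'a" where
  "gradient \<phi> x = (THE d. GDERIV \<phi> x :> d)"

definition cont_differentiable :: "('a::real_inner \<Rightarrow> real) \<Rightarrow> bool" where
  "cont_differentiable \<phi> \<longleftrightarrow>
     (\<forall>x. \<phi> differentiable (at x)) \<and> continuous_on UNIV (gradient \<phi>)"

text \<open>
  The numbers of constraints are natural numbers rather than index types, so that a group of
  constraints may be empty.  Constraint functions and multipliers are indexed by naturals, and only
  the indices in \<open>{1..numg}\<close>, \<open>{1..numh}\<close> and \<open>{1..numv}\<close> are ever used.  In particular, two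
  multiplier vectors agree iff they agree on those ranges.
\<close>

record ('n::finite) mpvc =
  obj  :: "real ^ 'n \<Rightarrow> real"
  numg :: nat
  numh :: nat
  numv :: nat
  gc :: "nat \<Rightarrow> real ^ 'n \<Rightarrow> real"
  hc :: "nat \<Rightarrow> real ^ 'n \<Rightarrow> real"
  Gc :: "nat \<Rightarrow> real ^ 'n \<Rightarrow> real"
  Hc :: "nat \<Rightarrow> real ^ 'n \<Rightarrow> real"

definition C1_mpvc :: "('n::finite) mpvc \<Rightarrow> bool" where
  "C1_mpvc P \<longleftrightarrow>
     cont_differentiable (obj P) \<and>
     (\<forall>i\<in>{1..numg P}. cont_differentiable (gc P i)) \<and>
     (\<forall>i\<in>{1..numh P}. cont_differentiable (hc P i)) \<and>
     (\<forall>i\<in>{1..numv P}. cont_differentiable (Gc P i) \<and> cont_differentiable (Hc P i))"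

definition feasible_set :: "('n::finite) mpvc \<Rightarrow> (real ^ 'n) set" where
  "feasible_set P = {x.
     (\<forall>i\<in>{1..numg P}. gc P i x \<le> 0) \<and>
     (\<forall>i\<in>{1..numh P}. hc P i x = 0) \<and>
     (\<forall>i\<in>{1..numv P}. Hc P i x \<ge> 0 \<and> Gc P i x * Hc P i x \<le> 0)}"

definition local_minimum :: "('n::finite) mpvc \<Rightarrow> real ^ 'n \<Rightarrow> bool" where
  "local_minimum P x \<longleftrightarrow>
     x \<in> feasible_set P \<and>
     (\<exists>\<epsilon>>0. \<forall>y\<in>feasible_set P \<inter> ball x \<epsilon>. obj P x \<le> obj P y)"

text \<open>In the names of the index sets, \<open>p\<close>, \<open>z\<close>, \<open>m\<close> stand for \<open>+\<close>, \<open>0\<close>, \<open>-\<close>; the first letter is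
  the sign of \<open>H\<close>, the second that of \<open>G\<close>.\<close>

definition I_g :: "('n::finite) mpvc \<Rightarrow> real ^ 'n \<Rightarrow> nat set" where
  "I_g P x = {i\<in>{1..numg P}. gc P i x = 0}"

definition I_p :: "('n::finite) mpvc \<Rightarrow> real ^ 'n \<Rightarrow> nat set" where
  "I_p P x = {i\<in>{1..numv P}. Hc P i x > 0}"

definition I_pz :: "('n::finite) mpvc \<Rightarrow> real ^ 'n \<Rightarrow> nat set" where
  "I_pz P x = {i\<in>{1..numv P}. Hc P i x > 0 \<and> Gc P i x = 0}"

definition I_pm :: "('n::finite) mpvc \<Rightarrow> real ^ 'n \<Rightarrow> nat set" where
  "I_pm P x = {i\<in>{1..numv P}. Hc P i x > 0 \<and> Gc P i x < 0}"

definition I_zz :: "('n::finite) mpvc \<Rightarrow> real ^ 'n \<Rightarrow> nat set" where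
  "I_zz P x = {i\<in>{1..numv P}. Hc P i x = 0 \<and> Gc P i x = 0}"

definition I_zp :: "('n::finite) mpvc \<Rightarrow> real ^ 'n \<Rightarrow> nat set" where
  "I_zp P x = {i\<in>{1..numv P}. Hc P i x = 0 \<and> Gc P i x > 0}"

definition I_zm :: "('n::finite) mpvc \<Rightarrow> real ^ 'n \<Rightarrow> nat set" where
  "I_zm P x = {i\<in>{1..numv P}. Hc P i x = 0 \<and> Gc P i x < 0}"

definition multipliers_zero ::
  "('n::finite) mpvc \<Rightarrow> (nat \<Rightarrow> real) \<Rightarrow> (nat \<Rightarrow> real) \<Rightarrow> (nat \<Rightarrow> real) \<Rightarrow> (nat \<Rightarrow> real) \<Rightarrow> bool" where
  "multipliers_zero P lam mu etaG etaH \<longleftrightarrow>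
     (\<forall>i\<in>{1..numg P}. lam i = 0) \<and>
     (\<forall>i\<in>{1..numh P}. mu i = 0) \<and>
     (\<forall>i\<in>{1..numv P}. etaG i = 0) \<and>
     (\<forall>i\<in>{1..numv P}. etaH i = 0)"

definition multiplier_gradient ::
  "('n::finite) mpvc \<Rightarrow> real ^ 'n \<Rightarrow> (nat \<Rightarrow> real) \<Rightarrow> (nat \<Rightarrow> real) \<Rightarrow> (nat \<Rightarrow> real) \<Rightarrow> (nat \<Rightarrow> real)
     \<Rightarrow> real ^ 'n" where
  "multiplier_gradient P x lam mu etaG etaH =
     (\<Sum>i = 1..numg P. lam i *\<^sub>R gradient (gc P i) x)
     + (\<Sum>i = 1..numh P. mu i *\<^sub>R gradient (hc P i) x)
     + (\<Sum>i = 1..numv P. etaG i *\<^sub>R gradient (Gc P i) x)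
     - (\<Sum>i = 1..numv P. etaH i *\<^sub>R gradient (Hc P i) x)"

text \<open>The component \<open>etaH i\<close> is unrestricted for \<open>i \<in> I_zp P x\<close>.\<close>

definition M_sign_conditions ::
  "('n::finite) mpvc \<Rightarrow> real ^ 'n \<Rightarrow> (nat \<Rightarrow> real) \<Rightarrow> (nat \<Rightarrow> real) \<Rightarrow> (nat \<Rightarrow> real) \<Rightarrow> (nat \<Rightarrow> real)
     \<Rightarrow> bool" where
  "M_sign_conditions P x lam mu etaG etaH \<longleftrightarrow>
     (\<forall>i\<in>I_g P x. lam i \<ge> 0) \<and>
     (\<forall>i\<in>{1..numg P} - I_g P x. lam i = 0) \<and>
     (\<forall>i\<in>I_pm P x \<union> I_zm P x \<union> I_zp P x. etaG i = 0) \<and>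
     (\<forall>i\<in>I_pz P x \<union> I_zz P x. etaG i \<ge> 0) \<and>
     (\<forall>i\<in>I_p P x. etaH i = 0) \<and>
     (\<forall>i\<in>I_zm P x. etaH i \<ge> 0) \<and>
     (\<forall>i\<in>I_zz P x. etaH i * etaG i = 0)"

definition quasinormality_sequence ::
  "('n::finite) mpvc \<Rightarrow> real ^ 'n \<Rightarrow> (nat \<Rightarrow> real) \<Rightarrow> (nat \<Rightarrow> real) \<Rightarrow> (nat \<Rightarrow> real) \<Rightarrow> (nat \<Rightarrow> real)
     \<Rightarrow> bool" where
  "quasinormality_sequence P x lam mu etaG etaH \<longleftrightarrow>
     (\<exists>X :: nat \<Rightarrow> real ^ 'n. X \<longlonglongrightarrow> x \<and>
       (\<forall>k.
         (\<forall>i\<in>{1..numg P}. lam i > 0 \<longrightarrow> lam i * gc P i (X k) > 0) \<and>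
         (\<forall>i\<in>{1..numh P}. mu i \<noteq> 0 \<longrightarrow> mu i * hc P i (X k) > 0) \<and>
         (\<forall>i\<in>{1..numv P}. etaH i \<noteq> 0 \<longrightarrow> etaH i * Hc P i (X k) < 0) \<and>
         (\<forall>i\<in>{1..numv P}. etaG i > 0 \<longrightarrow> etaG i * Gc P i (X k) > 0)))"

definition generalized_quasinormality :: "('n::finite) mpvc \<Rightarrow> real ^ 'n \<Rightarrow> bool" where
  "generalized_quasinormality P x \<longleftrightarrow>
     x \<in> feasible_set P \<and>
     \<not> (\<exists>lam mu etaG etaH.
          \<not> multipliers_zero P lam mu etaG etaH \<and>
          multiplier_gradient P x lam mu etaG etaH = 0 \<and>
          M_sign_conditions P x lam mu etaG etaH \<and>
          quasinormality_sequence P x lam mu etaG etaH)"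

definition enhanced_M_stationary :: "('n::finite) mpvc \<Rightarrow> real ^ 'n \<Rightarrow> bool" where
  "enhanced_M_stationary P x \<longleftrightarrow>
     x \<in> feasible_set P \<and>
     (\<exists>lam mu etaG etaH.
        M_sign_conditions P x lam mu etaG etaH \<and>
        gradient (obj P) x + multiplier_gradient P x lam mu etaG etaH = 0 \<and>
        (\<not> multipliers_zero P lam mu etaG etaH \<longrightarrow>
           quasinormality_sequence P x lam mu etaG etaH))"

end

theory Submission
  imports Defs
begin

text \<open>
  Near the local minimum, restrict the problem to the branch where \<open>H = 0\<close> on \<open>I_zp \<union> I_zz\<close>,
  \<open>H \<ge> 0\<close> on \<open>I_zm\<close> and \<open>G \<le> 0\<close> on \<open>I_pz\<close>.  This is an ordinary nonlinear program whose feasible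
  points are feasible for the original problem, so the point remains a local minimum, and the enhanced
  Fritz John conditions of the branch provide M-signed multipliers together with the sequence.  A
  vanishing objective multiplier would contradict generalized quasinormality.
\<close>

section \<open>Gradients, the squared positive part, and subsequences\<close>

text \<open>Since \<open>gradient\<close> is a definite description, both existence and uniqueness
  are required. A linear functional is the inner product with its adjoint at 1, and derivatives are
  unique.\<close>

lemma GDERIV_gradient:
  fixes \<phi> :: "'a::euclidean_space \<Rightarrow> real"
  assumes "\<phi> differentiable (at x)"
  shows "GDERIV \<phi> x :> gradient \<phi> x"
proof -
  obtain \<phi>' where \<phi>': "(\<phi> has_derivative \<phi>') (at x)"
    using assms unfolding differentiable_def by blast
  have "\<phi>' h = h \<bullet> adjoint \<phi>' 1" for h
    using adjoint_works[OF has_derivative_linear[OF \<phi>'], of h 1] by simp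
  then have "\<phi>' = (\<lambda>h. h \<bullet> adjoint \<phi>' 1)" by blast
  with \<phi>' have ex: "GDERIV \<phi> x :> adjoint \<phi>' 1"
    unfolding gderiv_def by simp
  have unique: "d = d'" if "GDERIV \<phi> x :> d" "GDERIV \<phi> x :> d'" for d d'
  proof -
    have "(\<lambda>h. h \<bullet> d) = (\<lambda>h. h \<bullet> d')"
      using that unfolding gderiv_def by (rule has_derivative_unique)
    then show ?thesis
      by (simp add: fun_eq_iff vector_eq_ldot)
  qed
  show ?thesis
    unfolding gradient_def by (rule theI, rule ex, rule unique, assumption, rule ex)
qed

text \<open>Squaring removes the kink of the positive part: at 0 the difference quotient is
  \<open>max 0 h\<close>, which tends to 0. This makes the quadratic penalty differentiable.\<close>

lemma DERIV_max_0_square: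
  fixes t :: real
  shows "DERIV (\<lambda>s. (max 0 s)\<^sup>2) t :> 2 * max 0 t"
proof -
  consider "t < 0" | "t = 0" | "t > 0" by linarith
  then show ?thesis
  proof cases
    case 1
    have "((\<lambda>s. 0) has_real_derivative 2 * max 0 t) (at t)"
      using 1 by (auto intro!: derivative_eq_intros)
    then show ?thesis
      by (rule has_field_derivative_transform_within_open[of _ _ _ "{..<0}"]) (use 1 in auto)
  next
    case 2
    have "((\<lambda>h. max 0 h) \<longlongrightarrow> max 0 (0::real)) (at 0)"
      by (intro tendsto_intros)
    moreover have "((max 0 h)\<^sup>2 - (max 0 0)\<^sup>2) / h = max 0 h" for h :: real
      by (cases "h = 0") (auto simp: max_def power2_eq_square)
    ultimately show ?thesis
      using 2 by (simp add: DERIV_def)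
  next
    case 3
    have "((\<lambda>s. s\<^sup>2) has_real_derivative 2 * max 0 t) (at t)"
      using 3 by (auto intro!: derivative_eq_intros)
    then show ?thesis
      by (rule has_field_derivative_transform_within_open[of _ _ _ "{0<..}"]) (use 3 in auto)
  qed
qed

text \<open>Bolzano-Weierstrass one index at a time: each refinement preserves the limits already
  obtained, so a single subsequence serves all of \<open>J\<close>.\<close>

lemma bounded_family_convergent_subsequence:
  fixes a :: "nat \<Rightarrow> 'j \<Rightarrow> real"
  assumes "finite J" and "\<And>j. j \<in> J \<Longrightarrow> bounded (range (\<lambda>k. a k j))"
  shows "\<exists>r l. strict_mono (r :: nat \<Rightarrow> nat) \<and> (\<forall>j\<in>J. (\<lambda>k. a (r k) j) \<longlonglongrightarrow> l j)"
  using assms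
proof (induction J rule: finite_induct)
  case empty
  show ?case using strict_mono_id by auto
next
  case (insert i J)
  then obtain r l where r: "strict_mono (r :: nat \<Rightarrow> nat)"
    and l: "\<And>j. j \<in> J \<Longrightarrow> (\<lambda>k. a (r k) j) \<longlonglongrightarrow> l j"
    by auto
  have "bounded (range (\<lambda>k. a (r k) i))"
    by (rule bounded_subset[of "range (\<lambda>k. a k i)"]) (use insert.prems in auto)
  then obtain u s where s: "strict_mono (s :: nat \<Rightarrow> nat)" and u: "(\<lambda>k. a (r (s k)) i) \<longlonglongrightarrow> u"
    using bounded_imp_convergent_subsequence[of "\<lambda>k. a (r k) i"] by (auto simp: o_def)
  have "(\<lambda>k. a (r (s k)) j) \<longlonglongrightarrow> (l(i := u)) j" if "j \<in> insert i J" for j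
    using that u insert.hyps LIMSEQ_subseq_LIMSEQ[OF l s] by (auto simp: o_def)
  moreover have "strict_mono (r \<circ> s)"
    using r s by (rule strict_mono_o)
  ultimately show ?case
    by (intro exI[of _ "r \<circ> s"] exI[of _ "l(i := u)"]) (simp add: o_def)
qed

section \<open>Quadratic penalties and enhanced Fritz John conditions\<close>

text \<open>The factor \<open>\<rho> / 2\<close> cancels the 2 from the square, so the coefficient
  of \<open>c' j\<close> is exactly the penalty weight that later becomes a multiplier.\<close>

lemma gderiv_penalty:
  fixes f :: "'a::euclidean_space \<Rightarrow> real"
  assumes "GDERIV f y :> f'" and "\<And>j. j \<in> J \<Longrightarrow> GDERIV (c j) y :> c' j"
  shows "GDERIV (\<lambda>y. f y + \<rho> / 2 * (\<Sum>j\<in>J. (max 0 (c j y))\<^sup>2) + (norm (y - x))\<^sup>2 / 2) y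
           :> f' + (\<Sum>j\<in>J. (\<rho> * max 0 (c j y)) *\<^sub>R c' j) + (y - x)"
proof -
  have f: "(f has_derivative (\<lambda>h. h \<bullet> f')) (at y)"
    using assms(1) by (simp add: gderiv_def)
  have c: "((\<lambda>y. (max 0 (c j y))\<^sup>2) has_derivative (\<lambda>h. h \<bullet> ((2 * max 0 (c j y)) *\<^sub>R c' j))) (at y)"
    if "j \<in> J" for j
    using GDERIV_DERIV_compose[OF assms(2)[OF that] DERIV_max_0_square] by (simp add: gderiv_def)
  have n: "((\<lambda>y. (norm (y - x))\<^sup>2 / 2) has_derivative (\<lambda>h. h \<bullet> (y - x))) (at y)"
    unfolding power2_norm_eq_inner
    by (auto intro!: derivative_eq_intros simp: inner_commute)
  have "((\<lambda>y. f y + \<rho> / 2 * (\<Sum>j\<in>J. (max 0 (c j y))\<^sup>2) + (norm (y - x))\<^sup>2 / 2) has_derivative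
      (\<lambda>h. h \<bullet> f' + \<rho> / 2 * (\<Sum>j\<in>J. h \<bullet> ((2 * max 0 (c j y)) *\<^sub>R c' j)) + h \<bullet> (y - x))) (at y)"
    by (intro has_derivative_add has_derivative_mult_right has_derivative_sum f n c)
  then show ?thesis
    unfolding gderiv_def
    by (rule has_derivative_eq_rhs)
      (simp add: fun_eq_iff inner_add_right inner_sum_right sum_distrib_left mult_ac)
qed

text \<open>
  Quadratic penalties: the multipliers are the limits of the penalty weights
  \<open>k * max 0 (c j)\<close> at the penalty minimisers, normalised to total weight one.
\<close>

lemma enhanced_fritz_john_inequalities:
  fixes f :: "'a::euclidean_space \<Rightarrow> real" and c :: "'j \<Rightarrow> 'a \<Rightarrow> real"
  assumes J: "finite J"
    and f: "\<And>y. GDERIV f y :> f' y" "isCont f' x"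
    and c: "\<And>j y. j \<in> J \<Longrightarrow> GDERIV (c j) y :> c' j y" "\<And>j. j \<in> J \<Longrightarrow> isCont (c' j) x"
    and feas: "\<And>j. j \<in> J \<Longrightarrow> c j x \<le> 0"
    and min: "eventually (\<lambda>y. (\<forall>j\<in>J. c j y \<le> 0) \<longrightarrow> f x \<le> f y) (nhds x)"
  obtains t l X where "0 \<le> t" and "\<And>j. j \<in> J \<Longrightarrow> 0 \<le> l j" and "t + (\<Sum>j\<in>J. l j) = 1"
    and "t *\<^sub>R f' x + (\<Sum>j\<in>J. l j *\<^sub>R c' j x) = 0"
    and "X \<longlonglongrightarrow> x" and "\<And>j k. j \<in> J \<Longrightarrow> l j > 0 \<Longrightarrow> c j (X (k::nat)) > 0"
proof -
  obtain d where "d > 0" and d: "\<And>y. dist y x < d \<Longrightarrow> (\<forall>j\<in>J. c j y \<le> 0) \<Longrightarrow> f x \<le> f y"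
    using min unfolding eventually_nhds_metric by blast
  \<comment> \<open>Half the radius keeps the closed ball, over which the penalty functions attain
    their minima, inside the region of local optimality.\<close>
  define e where "e = d / 2"
  have "e > 0" and e: "\<And>y. y \<in> cball x e \<Longrightarrow> (\<forall>j\<in>J. c j y \<le> 0) \<Longrightarrow> f x \<le> f y"
    using \<open>d > 0\<close> d unfolding e_def by (auto simp: dist_commute)
  have contf: "continuous_on S f" for S
    using f(1) unfolding gderiv_def
    by (meson has_derivative_continuous continuous_at_imp_continuous_on)
  have contc: "continuous_on S (c j)" if "j \<in> J" for S j
    using c(1)[OF that] unfolding gderiv_def
    by (meson has_derivative_continuous continuous_at_imp_continuous_on)
  define V where "V y = (\<Sum>j\<in>J. (max 0 (c j y))\<^sup>2)" for y
  \<comment> \<open>\<open>x\<close> may fail to be a strict local minimum; the proximal term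
    singles it out and forces the penalty minimisers to accumulate at \<open>x\<close>.\<close>
  define F where "F \<rho> y = f y + \<rho> / 2 * V y + (norm (y - x))\<^sup>2 / 2" for \<rho> y
  have contV: "continuous_on S V" for S
    unfolding V_def by (intro continuous_intros contc)
  have contF: "continuous_on S (F \<rho>)" for S \<rho>
    unfolding F_def by (intro continuous_intros contf contV) auto
  have V0: "V y \<ge> 0" for y
    unfolding V_def by (simp add: sum_nonneg)
  have Vx: "V x = 0"
    unfolding V_def using feas by (intro sum.neutral) (auto simp: max_def intro: antisym)
  have "\<exists>z\<in>cball x e. \<forall>y\<in>cball x e. F (real k) z \<le> F (real k) y" for k
    by (rule continuous_attains_inf) (use \<open>e > 0\<close> contF in auto)
  then obtain Z where Z: "\<And>k. Z k \<in> cball x e"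
    and Zmin: "\<And>k y. y \<in> cball x e \<Longrightarrow> F (real k) (Z k) \<le> F (real k) y"
    by metis
  obtain z r where z: "z \<in> cball x e" and r: "strict_mono (r :: nat \<Rightarrow> nat)"
    and lim: "(Z \<circ> r) \<longlonglongrightarrow> z"
    using compact_cball[of x e] Z unfolding compact_def by metis
  define Y where "Y = Z \<circ> r"
  have Y: "Y \<longlonglongrightarrow> z" using lim by (simp add: Y_def)
  have fY: "(\<lambda>k. f (Y k)) \<longlonglongrightarrow> f z" and VY: "(\<lambda>k. V (Y k)) \<longlonglongrightarrow> V z"
    using Y contf[of UNIV] contV[of UNIV]
    by (auto simp: continuous_on_eq_continuous_at intro: isCont_tendsto_compose)
  have le: "f (Y k) + real (r k) / 2 * V (Y k) + (norm (Y k - x))\<^sup>2 / 2 \<le> f x" for k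
    using Zmin[of x "r k"] \<open>e > 0\<close> Vx by (simp add: F_def Y_def)
  have rtop: "filterlim (\<lambda>k. real (r k)) at_top sequentially"
    by (rule filterlim_compose[OF filterlim_real_sequentially filterlim_subseq[OF r]])
  \<comment> \<open>Dropping the proximal term from \<open>le\<close> bounds the violation by a
    convergent factor times \<open>2 / r k\<close>, which tends to 0; hence the limit
    \<open>z\<close> satisfies every constraint. The product with 0 is left in the form the limit
    rules produce.\<close>
  have "V z \<le> (f x - f z) * (2 * 0)"
  proof (rule tendsto_le)
    show "(\<lambda>k. (f x - f (Y k)) * (2 * inverse (real (r k)))) \<longlonglongrightarrow> (f x - f z) * (2 * 0)"
      by (intro tendsto_intros fY tendsto_inverse_0_at_top rtop)
    have "eventually (\<lambda>k. real (r k) > 0) sequentially"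
      using rtop unfolding filterlim_at_top_dense by blast
    then show "\<forall>\<^sub>F k in sequentially. V (Y k) \<le> (f x - f (Y k)) * (2 * inverse (real (r k)))"
    proof eventually_elim
      case (elim k)
      have "real (r k) / 2 * V (Y k) \<le> f x - f (Y k)"
        using le[of k] zero_le_power2[of "norm (Y k - x)"] by linarith
      with elim show ?case by (simp add: field_simps)
    qed
  qed (use VY in auto)
  with V0[of z] have "V z = 0" by simp
  then have "c j z \<le> 0" if "j \<in> J" for j
    using that J by (auto simp: V_def sum_nonneg_eq_0_iff max_def split: if_splits)
  with e z have "f x \<le> f z" by blast
  \<comment> \<open>Now the penalty term is dropped instead. Together with the optimality of
    \<open>x\<close> against the feasible point \<open>z\<close>, this leaves no room for a positive
    distance.\<close>
  moreover have "f z + (norm (z - x))\<^sup>2 / 2 \<le> f x"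
  proof (rule tendsto_le[OF _ tendsto_const])
    show "(\<lambda>k. f (Y k) + (norm (Y k - x))\<^sup>2 / 2) \<longlonglongrightarrow> f z + (norm (z - x))\<^sup>2 / 2"
      by (intro tendsto_intros fY Y) auto
    have "f (Y k) + (norm (Y k - x))\<^sup>2 / 2 \<le> f x" for k
      using le[of k] V0[of "Y k"] by (smt (verit) divide_nonneg_pos mult_nonneg_nonneg of_nat_0_le_iff)
    then show "\<forall>\<^sub>F k in sequentially. f (Y k) + (norm (Y k - x))\<^sup>2 / 2 \<le> f x"
      by simp
  qed simp
  ultimately have "(norm (z - x))\<^sup>2 \<le> 0" by linarith
  then have "z = x" by simp
  with Y have Y: "Y \<longlonglongrightarrow> x" by simp
  define w where "w k j = real (r k) * max 0 (c j (Y k))" for k j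
  \<comment> \<open>The weights \<open>w\<close> may be unbounded. Dividing by
    \<open>\<delta>\<close>, which counts the objective with weight 1, places all coefficients in
    [0,1] with sum one, so their limits exist along a subsequence and cannot all vanish.\<close>
  define \<delta> where "\<delta> k = 1 + (\<Sum>j\<in>J. w k j)" for k
  define a where "a k j = w k j / \<delta> k" for k j
  have w0: "w k j \<ge> 0" for k j
    by (simp add: w_def)
  then have \<delta>: "\<delta> k \<ge> 1" for k
    by (simp add: \<delta>_def sum_nonneg)
  have a0: "a k j \<ge> 0" for k j
    unfolding a_def by (smt (verit) \<delta> w0 divide_nonneg_nonneg)
  have suma: "(\<Sum>j\<in>J. a k j) = 1 - 1 / \<delta> k" for k
    using \<delta>[of k] by (simp add: a_def \<delta>_def flip: sum_divide_distrib) (simp add: field_simps)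
  have "bounded (range (\<lambda>k. a k j))" if "j \<in> J" for j
  proof (rule boundedI[of _ 1], clarify)
    fix k
    have "a k j \<le> (\<Sum>j\<in>J. a k j)"
      by (rule member_le_sum) (use that J a0 in auto)
    also have "\<dots> \<le> 1"
      unfolding suma using \<delta>[of k] by simp
    finally show "norm (a k j) \<le> 1"
      using a0[of k j] by simp
  qed
  then obtain q l where q: "strict_mono (q :: nat \<Rightarrow> nat)"
    and l: "\<And>j. j \<in> J \<Longrightarrow> (\<lambda>k. a (q k) j) \<longlonglongrightarrow> l j"
    using bounded_family_convergent_subsequence[OF J, of a] by auto
  define t where "t = 1 - (\<Sum>j\<in>J. l j)"
  have "(\<lambda>k. 1 - (\<Sum>j\<in>J. a (q k) j)) \<longlonglongrightarrow> t"
    unfolding t_def by (intro tendsto_intros l)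
  then have t: "(\<lambda>k. 1 / \<delta> (q k)) \<longlonglongrightarrow> t"
    by (simp add: suma)
  have "t \<ge> 0"
  proof (rule LIMSEQ_le_const[OF t], intro exI allI impI)
    show "0 \<le> 1 / \<delta> (q k)" for k
      using \<delta>[of "q k"] by simp
  qed
  have Yq: "(\<lambda>k. Y (q k)) \<longlonglongrightarrow> x"
    using LIMSEQ_subseq_LIMSEQ[OF Y q] by (simp add: o_def)
  \<comment> \<open>A minimiser over the closed ball is stationary only if it is interior;
    convergence to \<open>x\<close> ensures this eventually.\<close>
  have stat: "f' (Y k) + (\<Sum>j\<in>J. w k j *\<^sub>R c' j (Y k)) + (Y k - x) = 0" if "Y k \<in> ball x e" for k
  proof -
    have "GDERIV (F (real (r k))) (Y k) :>
        f' (Y k) + (\<Sum>j\<in>J. w k j *\<^sub>R c' j (Y k)) + (Y k - x)" (is "GDERIV _ _ :> ?g")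
      unfolding F_def V_def w_def by (rule gderiv_penalty) (use f c in auto)
    then have "(\<lambda>h. h \<bullet> ?g) = (\<lambda>h. 0)"
      unfolding gderiv_def
      by (rule differential_zero_maxmin[OF that open_ball])
        (use Zmin[of _ "r k"] in \<open>auto simp: Y_def\<close>)
    then show ?thesis
      by (metis inner_eq_zero_iff)
  qed
  \<comment> \<open>This is the limit of the stationarity equations divided by
    \<open>\<delta>\<close>; the summand \<open>x - x\<close> is the limit of the proximal
    gradient.\<close>
  have "t *\<^sub>R (f' x + (x - x)) + (\<Sum>j\<in>J. l j *\<^sub>R c' j x) = 0"
  proof (rule LIMSEQ_unique)
    show "(\<lambda>k. (1 / \<delta> (q k)) *\<^sub>R (f' (Y (q k)) + (Y (q k) - x))
        + (\<Sum>j\<in>J. a (q k) j *\<^sub>R c' j (Y (q k))))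
      \<longlonglongrightarrow> t *\<^sub>R (f' x + (x - x)) + (\<Sum>j\<in>J. l j *\<^sub>R c' j x)"
      by (intro tendsto_intros t l Yq isCont_tendsto_compose[OF f(2)] isCont_tendsto_compose[OF c(2)])
    have "\<forall>\<^sub>F k in sequentially. Y (q k) \<in> ball x e"
      by (rule topological_tendstoD[OF Yq]) (use \<open>e > 0\<close> in auto)
    then have "\<forall>\<^sub>F k in sequentially. 0 = (1 / \<delta> (q k)) *\<^sub>R (f' (Y (q k)) + (Y (q k) - x))
        + (\<Sum>j\<in>J. a (q k) j *\<^sub>R c' j (Y (q k)))"
    proof eventually_elim
      case (elim k)
      have "(\<Sum>j\<in>J. a (q k) j *\<^sub>R c' j (Y (q k)))
          = (1 / \<delta> (q k)) *\<^sub>R (\<Sum>j\<in>J. w (q k) j *\<^sub>R c' j (Y (q k)))"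
        by (simp add: a_def scaleR_sum_right)
      then show ?case
        using stat[OF elim] by (simp add: algebra_simps flip: scaleR_add_right)
    qed
    then show "(\<lambda>k. (1 / \<delta> (q k)) *\<^sub>R (f' (Y (q k)) + (Y (q k) - x))
        + (\<Sum>j\<in>J. a (q k) j *\<^sub>R c' j (Y (q k)))) \<longlonglongrightarrow> 0"
      by (rule Lim_transform_eventually[OF tendsto_const])
  qed
  \<comment> \<open>A positive limit makes the weights eventually positive, and a weight is positive
    only where its constraint is violated. Finiteness of \<open>J\<close> gives a common threshold,
    removed below by shifting the sequence by \<open>N\<close>.\<close>
  moreover have "\<forall>\<^sub>F k in sequentially. \<forall>j\<in>J. l j > 0 \<longrightarrow> c j (Y (q k)) > 0"
  proof (rule eventually_ball_finite[OF J], rule ballI)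
    fix j assume j: "j \<in> J"
    show "\<forall>\<^sub>F k in sequentially. l j > 0 \<longrightarrow> c j (Y (q k)) > 0"
    proof (cases "l j > 0")
      case True
      then have "\<forall>\<^sub>F k in sequentially. a (q k) j > 0"
        by (rule order_tendstoD(1)[OF l[OF j]])
      then show ?thesis
        by eventually_elim (rule ccontr, simp add: a_def w_def)
    qed simp
  qed
  then obtain N where N: "\<And>k. k \<ge> N \<Longrightarrow> \<forall>j\<in>J. l j > 0 \<longrightarrow> c j (Y (q k)) > 0"
    unfolding eventually_sequentially by blast
  moreover have "(\<lambda>k. Y (q (k + N))) \<longlonglongrightarrow> x"
    using LIMSEQ_ignore_initial_segment[OF Yq] .
  moreover have "l j \<ge> 0" if "j \<in> J" for j
    using a0 by (intro LIMSEQ_le_const[OF l[OF that]]) blast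
  ultimately show thesis
    using \<open>t \<ge> 0\<close> by (intro that[of t l "\<lambda>k. Y (q (k + N))"]) (simp_all add: t_def)
qed

text \<open>Differences of multipliers do not preserve a total weight of one, so the normalisation
  becomes a dichotomy: objective coefficient 1, or coefficient 0 with a nontrivial constraint
  multiplier.\<close>

lemma enhanced_fritz_john:
  fixes f :: "'a::euclidean_space \<Rightarrow> real" and c :: "'j \<Rightarrow> 'a \<Rightarrow> real" and h :: "'i \<Rightarrow> 'a \<Rightarrow> real"
  assumes J: "finite J" and E: "finite E"
    and f: "\<And>y. GDERIV f y :> f' y" "isCont f' x"
    and c: "\<And>j y. j \<in> J \<Longrightarrow> GDERIV (c j) y :> c' j y" "\<And>j. j \<in> J \<Longrightarrow> isCont (c' j) x"
    and h: "\<And>i y. i \<in> E \<Longrightarrow> GDERIV (h i) y :> h' i y" "\<And>i. i \<in> E \<Longrightarrow> isCont (h' i) x"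
    and feas: "\<And>j. j \<in> J \<Longrightarrow> c j x \<le> 0" "\<And>i. i \<in> E \<Longrightarrow> h i x = 0"
    and min: "eventually (\<lambda>y. (\<forall>j\<in>J. c j y \<le> 0) \<longrightarrow> (\<forall>i\<in>E. h i y = 0) \<longrightarrow> f x \<le> f y) (nhds x)"
  obtains t l m X where "t = 1 \<or> t = 0 \<and> ((\<exists>j\<in>J. l j \<noteq> 0) \<or> (\<exists>i\<in>E. m i \<noteq> 0))"
    and "\<And>j. j \<in> J \<Longrightarrow> 0 \<le> l j"
    and "t *\<^sub>R f' x + (\<Sum>j\<in>J. l j *\<^sub>R c' j x) + (\<Sum>i\<in>E. m i *\<^sub>R h' i x) = 0"
    and "X \<longlonglongrightarrow> x"
    and "\<And>j k. j \<in> J \<Longrightarrow> l j > 0 \<Longrightarrow> c j (X k) > 0"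
    and "\<And>i k. i \<in> E \<Longrightarrow> m i \<noteq> 0 \<Longrightarrow> m i * h i (X (k::nat)) > 0"
proof -
  \<comment> \<open>Each equation is split into two inequalities; both cannot be violated at the same point,
    so at most one of the two multipliers is nonzero.\<close>
  let ?K = "J <+> (E <+> E)"
  let ?C = "case_sum c (case_sum h (\<lambda>i y. - h i y))"
  let ?C' = "case_sum c' (case_sum h' (\<lambda>i y. - h' i y))"
  obtain s L X where s: "0 \<le> s" and L0: "\<And>j. j \<in> ?K \<Longrightarrow> 0 \<le> L j"
    and one: "s + (\<Sum>j\<in>?K. L j) = 1"
    and eq: "s *\<^sub>R f' x + (\<Sum>j\<in>?K. L j *\<^sub>R ?C' j x) = 0"
    and X: "X \<longlonglongrightarrow> x" and Xpos: "\<And>j k. j \<in> ?K \<Longrightarrow> L j > 0 \<Longrightarrow> ?C j (X k) > 0"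
  proof (rule enhanced_fritz_john_inequalities[of ?K f f' x ?C ?C'])
    show "finite ?K" using J E by simp
    show "GDERIV (?C j) y :> ?C' j y" if "j \<in> ?K" for j y
      using that c h by (auto intro!: GDERIV_minus)
    show "isCont (?C' j) x" if "j \<in> ?K" for j
      using that c h by (auto intro: continuous_minus)
    show "?C j x \<le> 0" if "j \<in> ?K" for j
      using that feas by auto
    show "\<forall>\<^sub>F y in nhds x. (\<forall>j\<in>?K. ?C j y \<le> 0) \<longrightarrow> f x \<le> f y"
      using min
    proof eventually_elim
      case (elim y)
      show ?case
      proof
        assume K: "\<forall>j\<in>?K. ?C j y \<le> 0"
        have "c j y \<le> 0" if "j \<in> J" for j
          using K[rule_format, of "Inl j"] that by auto
        moreover have "h i y = 0" if "i \<in> E" for i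
          using K[rule_format, OF InrI[OF InlI[OF that]]] K[rule_format, OF InrI[OF InrI[OF that]]]
          by simp
        ultimately show "f x \<le> f y" using elim by blast
      qed
    qed
  qed (use f in auto)
  \<comment> \<open>Rescaling turns a positive objective coefficient into 1; if it is zero, the
    multipliers are left as they are.\<close>
  define \<alpha> where "\<alpha> = (if s = 0 then 1 else 1 / s)"
  define l where "l j = \<alpha> * L (Inl j)" for j
  define M where "M i = L (Inr (Inl i)) - L (Inr (Inr i))" for i
  define m where "m i = \<alpha> * M i" for i
  have \<alpha>: "\<alpha> > 0" using s by (simp add: \<alpha>_def)
  have eq': "s *\<^sub>R f' x + (\<Sum>j\<in>J. L (Inl j) *\<^sub>R c' j x) + (\<Sum>i\<in>E. M i *\<^sub>R h' i x) = 0"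
    using eq J E by (simp add: sum.Plus o_def M_def scaleR_diff_left sum_subtractf sum_negf add.assoc)
  have Lh: "L (Inr (Inl i)) \<ge> 0" "L (Inr (Inr i)) \<ge> 0"
    "L (Inr (Inl i)) > 0 \<Longrightarrow> h i (X k) > 0" "L (Inr (Inr i)) > 0 \<Longrightarrow> h i (X k) < 0"
    if "i \<in> E" for i k
    using that L0 Xpos[of "Inr (Inl i)" k] Xpos[of "Inr (Inr i)" k] by auto
  show thesis
  proof (rule that[of "\<alpha> * s" l m X])
    \<comment> \<open>Vanishing differences \<open>M i\<close> could in principle hide equal
      positive multipliers, but these would give \<open>h i (X 0)\<close> both signs. So every
      \<open>L j\<close> would be zero, against the total weight one.\<close>
    have False if "s = 0" "\<forall>j\<in>J. L (Inl j) = 0" "\<forall>i\<in>E. M i = 0"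
    proof -
      have "L (Inr (Inl i)) = 0 \<and> L (Inr (Inr i)) = 0" if "i \<in> E" for i
        using Lh(1,2)[OF that] Lh(3,4)[OF that, of 0] \<open>\<forall>i\<in>E. M i = 0\<close> that by (fastforce simp: M_def)
      then have "(\<Sum>j\<in>?K. L j) = 0"
        using \<open>\<forall>j\<in>J. L (Inl j) = 0\<close> by (intro sum.neutral) auto
      with one \<open>s = 0\<close> show False by simp
    qed
    then show "\<alpha> * s = 1 \<or> \<alpha> * s = 0 \<and> ((\<exists>j\<in>J. l j \<noteq> 0) \<or> (\<exists>i\<in>E. m i \<noteq> 0))"
      by (auto simp: \<alpha>_def l_def m_def)
    show "0 \<le> l j" if "j \<in> J" for j
      using \<alpha> L0[OF InlI[OF that]] by (simp add: l_def)
    have "(\<alpha> * s) *\<^sub>R f' x + (\<Sum>j\<in>J. l j *\<^sub>R c' j x) + (\<Sum>i\<in>E. m i *\<^sub>R h' i x)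
      = \<alpha> *\<^sub>R (s *\<^sub>R f' x + (\<Sum>j\<in>J. L (Inl j) *\<^sub>R c' j x) + (\<Sum>i\<in>E. M i *\<^sub>R h' i x))"
      by (simp add: l_def m_def scaleR_add_right scaleR_sum_right)
    with eq' show "(\<alpha> * s) *\<^sub>R f' x + (\<Sum>j\<in>J. l j *\<^sub>R c' j x) + (\<Sum>i\<in>E. m i *\<^sub>R h' i x) = 0"
      by simp
    show "X \<longlonglongrightarrow> x" by (rule X)
    show "c j (X k) > 0" if "j \<in> J" "l j > 0" for j k
      using Xpos[OF InlI[OF that(1)], of k] that(2) \<alpha> by (simp add: l_def zero_less_mult_iff)
    show "m i * h i (X k) > 0" if "i \<in> E" "m i \<noteq> 0" for i k
    proof -
      have "M i \<noteq> 0" using that by (simp add: m_def)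
      then have "M i * h i (X k) > 0"
        using Lh(1,2)[OF \<open>i \<in> E\<close>] Lh(3,4)[OF \<open>i \<in> E\<close>, of k] unfolding M_def
        by (smt (verit) mult_pos_pos mult_neg_neg)
      then show ?thesis using \<alpha> by (simp add: m_def mult.assoc)
    qed
  qed
qed

section \<open>Application to the program with vanishing constraints\<close>

lemma cont_differentiable_gradient:
  fixes \<phi> :: "'a::euclidean_space \<Rightarrow> real"
  assumes "cont_differentiable \<phi>"
  shows "GDERIV \<phi> y :> gradient \<phi> y" and "isCont (gradient \<phi>) y" and "isCont \<phi> y"
proof -
  have d: "\<phi> differentiable (at y)"
    using assms by (simp add: cont_differentiable_def)
  show "GDERIV \<phi> y :> gradient \<phi> y" "isCont \<phi> y"
    using GDERIV_gradient[OF d] differentiable_imp_continuous_within[OF d] by simp_all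
  show "isCont (gradient \<phi>) y"
    using assms by (simp add: cont_differentiable_def continuous_on_eq_continuous_at)
qed

theorem theorem4p3:
  fixes P :: "('n::finite) mpvc" and x :: "real ^ 'n"
  assumes "C1_mpvc P"
    and "local_minimum P x"
    and "generalized_quasinormality P x"
  shows "enhanced_M_stationary P x"
proof -
  have xf: "x \<in> feasible_set P"
    using assms(2) by (simp add: local_minimum_def)
  then have gx: "\<And>i. i \<in> {1..numg P} \<Longrightarrow> gc P i x \<le> 0"
    and hx: "\<And>i. i \<in> {1..numh P} \<Longrightarrow> hc P i x = 0"
    and Hx: "\<And>i. i \<in> {1..numv P} \<Longrightarrow> Hc P i x \<ge> 0"
    and GHx: "\<And>i. i \<in> {1..numv P} \<Longrightarrow> Gc P i x * Hc P i x \<le> 0"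
    by (auto simp: feasible_set_def)
  have C1: "cont_differentiable (obj P)"
    "\<And>i. i \<in> {1..numg P} \<Longrightarrow> cont_differentiable (gc P i)"
    "\<And>i. i \<in> {1..numh P} \<Longrightarrow> cont_differentiable (hc P i)"
    "\<And>i. i \<in> {1..numv P} \<Longrightarrow> cont_differentiable (Gc P i)"
    "\<And>i. i \<in> {1..numv P} \<Longrightarrow> cont_differentiable (Hc P i)"
    using assms(1) by (auto simp: C1_mpvc_def)
  note grad = cont_differentiable_gradient
  have eventually_imp: "\<forall>\<^sub>F y in nhds x. A \<longrightarrow> B y" if "A \<Longrightarrow> \<forall>\<^sub>F y in nhds x. B y"
    for A and B :: "real ^ 'n \<Rightarrow> bool"
    using that by (cases A) auto
  have neg: "\<forall>\<^sub>F y in nhds x. \<phi> y < 0" if "\<phi> x < 0" "cont_differentiable \<phi>" for \<phi>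
    using grad(3)[OF that(2), of x] that(1) unfolding isCont_def tendsto_at_iff_tendsto_nhds
    by (rule order_tendstoD)
  have pos: "\<forall>\<^sub>F y in nhds x. \<phi> y > 0" if "\<phi> x > 0" "cont_differentiable \<phi>" for \<phi>
    using grad(3)[OF that(2), of x] that(1) unfolding isCont_def tendsto_at_iff_tendsto_nhds
    by (rule order_tendstoD)
  have sub: "I_g P x \<subseteq> {1..numg P}" "I_pz P x \<subseteq> {1..numv P}" "I_zm P x \<subseteq> {1..numv P}"
    "I_zp P x \<union> I_zz P x \<subseteq> {1..numv P}"
    by (auto simp: I_g_def I_pz_def I_zm_def I_zp_def I_zz_def)
  have C1': "\<And>i. i \<in> I_g P x \<Longrightarrow> cont_differentiable (gc P i)"
    "\<And>i. i \<in> I_pz P x \<Longrightarrow> cont_differentiable (Gc P i)"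
    "\<And>i. i \<in> I_zm P x \<Longrightarrow> cont_differentiable (Hc P i)"
    "\<And>i. i \<in> I_zp P x \<Longrightarrow> cont_differentiable (Hc P i)"
    "\<And>i. i \<in> I_zz P x \<Longrightarrow> cont_differentiable (Hc P i)"
    using C1 sub by blast+
  note fin = sub[THEN finite_subset, OF finite_atLeastAtMost]
  \<comment> \<open>Only constraints active at \<open>x\<close> enter the branch. The inactive ones
    hold strictly at \<open>x\<close>, hence also nearby by continuity.\<close>
  let ?J = "I_g P x <+> (I_pz P x <+> I_zm P x)"
  let ?c = "case_sum (gc P) (case_sum (Gc P) (\<lambda>i y. - Hc P i y))"
  let ?c' = "case_sum (\<lambda>i. gradient (gc P i))
    (case_sum (\<lambda>i. gradient (Gc P i)) (\<lambda>i y. - gradient (Hc P i) y))"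
  \<comment> \<open>On \<open>I_zz\<close> the vanishing constraint is replaced by its branch \<open>H = 0\<close>, with \<open>G\<close> unconstrained.
    This shrinks the feasible set, and it forces \<open>etaG = 0\<close> there while \<open>etaH\<close> stays free.\<close>
  let ?E = "{1..numh P} <+> (I_zp P x \<union> I_zz P x)"
  let ?h = "case_sum (hc P) (Hc P)"
  let ?h' = "case_sum (\<lambda>i. gradient (hc P i)) (\<lambda>i. gradient (Hc P i))"
  obtain t l m X where t: "t = 1 \<or> t = 0 \<and> ((\<exists>j\<in>?J. l j \<noteq> 0) \<or> (\<exists>i\<in>?E. m i \<noteq> 0))"
    and l: "\<And>j. j \<in> ?J \<Longrightarrow> 0 \<le> l j"
    and eq: "t *\<^sub>R gradient (obj P) x + (\<Sum>j\<in>?J. l j *\<^sub>R ?c' j x) + (\<Sum>i\<in>?E. m i *\<^sub>R ?h' i x) = 0"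
    and X: "X \<longlonglongrightarrow> x"
    and Xc: "\<And>j k. j \<in> ?J \<Longrightarrow> l j > 0 \<Longrightarrow> ?c j (X k) > 0"
    and Xh: "\<And>i k. i \<in> ?E \<Longrightarrow> m i \<noteq> 0 \<Longrightarrow> m i * ?h i (X (k::nat)) > 0"
  proof (rule enhanced_fritz_john[of ?J ?E "obj P" "gradient (obj P)" x ?c ?c' ?h ?h'])
    show "finite ?J" "finite ?E" using fin by auto
    show "GDERIV (?c j) y :> ?c' j y" if "j \<in> ?J" for j y
      using that by (auto intro!: GDERIV_minus grad intro: C1')
    show "isCont (?c' j) x" if "j \<in> ?J" for j
      using that by (auto intro!: continuous_minus grad intro: C1')
    show "GDERIV (?h i) y :> ?h' i y" if "i \<in> ?E" for i y
      using that by (auto intro!: grad intro: C1[simplified] C1')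
    show "isCont (?h' i) x" if "i \<in> ?E" for i
      using that by (auto intro!: grad intro: C1[simplified] C1')
    show "?c j x \<le> 0" if "j \<in> ?J" for j
      using that by (auto simp: I_g_def I_pz_def I_zm_def)
    show "?h i x = 0" if "i \<in> ?E" for i
      using that hx by (auto simp: I_zp_def I_zz_def)
    obtain \<epsilon> where "\<epsilon> > 0" and \<epsilon>: "\<And>y. y \<in> feasible_set P \<Longrightarrow> y \<in> ball x \<epsilon> \<Longrightarrow> obj P x \<le> obj P y"
      using assms(2) by (auto simp: local_minimum_def)
    have "\<forall>\<^sub>F y in nhds x. y \<in> ball x \<epsilon>"
      using \<open>\<epsilon> > 0\<close> by (intro eventually_nhds_in_open) auto
    moreover have "\<forall>\<^sub>F y in nhds x. \<forall>i\<in>{1..numg P}. i \<notin> I_g P x \<longrightarrow> gc P i y < 0"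
    proof (intro eventually_ball_finite ballI eventually_imp)
      show "\<forall>\<^sub>F y in nhds x. gc P i y < 0" if "i \<in> {1..numg P}" "i \<notin> I_g P x" for i
        using that gx[OF that(1)] by (intro neg C1) (auto simp: I_g_def)
    qed simp
    moreover have "\<forall>\<^sub>F y in nhds x. \<forall>i\<in>{1..numv P}.
        (Hc P i x > 0 \<longrightarrow> Hc P i y > 0) \<and> (Gc P i x < 0 \<longrightarrow> Gc P i y < 0)"
      by (intro eventually_ball_finite ballI eventually_conj)
        (auto intro!: neg pos C1 eventually_imp)
    ultimately show "\<forall>\<^sub>F y in nhds x. (\<forall>j\<in>?J. ?c j y \<le> 0) \<longrightarrow> (\<forall>i\<in>?E. ?h i y = 0)
        \<longrightarrow> obj P x \<le> obj P y"
    proof eventually_elim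
      case (elim y)
      show ?case
      proof (intro impI)
        assume cy: "\<forall>j\<in>?J. ?c j y \<le> 0" and hy: "\<forall>i\<in>?E. ?h i y = 0"
        have "gc P i y \<le> 0" if "i \<in> {1..numg P}" for i
          using cy[rule_format, of "Inl i"] elim(2) that by fastforce
        moreover have "hc P i y = 0" if "i \<in> {1..numh P}" for i
          using hy[rule_format, OF InlI[OF that]] by simp
        moreover have "Hc P i y \<ge> 0 \<and> Gc P i y * Hc P i y \<le> 0" if i: "i \<in> {1..numv P}" for i
        proof -
          \<comment> \<open>Feasibility of \<open>x\<close> excludes \<open>H > 0\<close> with
            \<open>G > 0\<close>, so the four cases below are exhaustive.\<close>
          have "Gc P i x \<le> 0" if "Hc P i x > 0"
            using GHx[OF i] that by (simp add: mult_le_0_iff)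
          then consider "i \<in> I_pz P x" | "i \<in> I_pm P x" | "i \<in> I_zm P x" | "i \<in> I_zp P x \<union> I_zz P x"
            using i Hx[OF i] by (fastforce simp: I_pz_def I_pm_def I_zm_def I_zp_def I_zz_def)
          then show ?thesis
          proof cases
            case 1
            then have "Gc P i y \<le> 0" "Hc P i y > 0"
              using cy[rule_format, of "Inr (Inl i)"] elim(3) i by (auto simp: I_pz_def)
            then show ?thesis by (simp add: mult_le_0_iff)
          next
            case 2
            then have "Gc P i y < 0" "Hc P i y > 0"
              using elim(3) i by (auto simp: I_pm_def)
            then show ?thesis by (simp add: mult_le_0_iff)
          next
            case 3
            then have "Gc P i y < 0" "Hc P i y \<ge> 0"
              using cy[rule_format, of "Inr (Inr i)"] elim(3) i by (auto simp: I_zm_def)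
            then show ?thesis by (simp add: mult_le_0_iff)
          next
            case 4
            have "Hc P i y = 0"
              using hy[rule_format, OF InrI[OF 4]] by simp
            then show ?thesis by simp
          qed
        qed
        ultimately have "y \<in> feasible_set P"
          by (simp add: feasible_set_def)
        with \<epsilon> elim(1) show "obj P x \<le> obj P y" by blast
      qed
    qed
  qed (use C1 grad in auto)
  define lam where "lam i = (if i \<in> I_g P x then l (Inl i) else 0)" for i
  define mu where "mu i = m (Inl i)" for i
  define etaG where "etaG i = (if i \<in> I_pz P x then l (Inr (Inl i)) else 0)" for i
  define etaH where "etaH i = (if i \<in> I_zm P x then l (Inr (Inr i)) else 0)
    - (if i \<in> I_zp P x \<union> I_zz P x then m (Inr i) else 0)" for i
  have disj: "i \<notin> I_zp P x \<union> I_zz P x" if "i \<in> I_zm P x" for i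
    using that by (auto simp: I_zm_def I_zp_def I_zz_def)
  have restrict: "(\<Sum>i\<in>B. (if i \<in> A then u i else 0) *\<^sub>R v i) = (\<Sum>i\<in>A. u i *\<^sub>R v i)"
    if "A \<subseteq> B" "finite B" for A B :: "nat set" and u and v :: "nat \<Rightarrow> real ^ 'n"
    using that by (intro sum.mono_neutral_cong_right) auto
  have "multiplier_gradient P x lam mu etaG etaH
      = (\<Sum>j\<in>?J. l j *\<^sub>R ?c' j x) + (\<Sum>i\<in>?E. m i *\<^sub>R ?h' i x)"
    using fin
    by (simp add: multiplier_gradient_def lam_def mu_def etaG_def etaH_def scaleR_diff_left
        sum_subtractf sub[THEN restrict, OF finite_atLeastAtMost, unfolded One_nat_def] sum.Plus o_def sum_negf del: Un_iff)
  with eq have stat: "t *\<^sub>R gradient (obj P) x + multiplier_gradient P x lam mu etaG etaH = 0"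
    by (simp add: add.assoc)
  have sign: "M_sign_conditions P x lam mu etaG etaH"
    using l[of "Inl _"] l[of "Inr (Inl _)"] l[of "Inr (Inr _)"]
    unfolding M_sign_conditions_def lam_def etaG_def etaH_def
    by (auto simp: I_p_def I_pz_def I_pm_def I_zz_def I_zp_def I_zm_def)
  have seq: "quasinormality_sequence P x lam mu etaG etaH"
    unfolding quasinormality_sequence_def
  proof (intro exI[of _ X] conjI allI ballI impI)
    show "X \<longlonglongrightarrow> x" by (rule X)
    show "lam i * gc P i (X k) > 0" if "lam i > 0" for i k
      using that Xc[OF InlI, of i k] by (simp add: lam_def split: if_splits)
    show "mu i * hc P i (X k) > 0" if "i \<in> {1..numh P}" "mu i \<noteq> 0" for i k
      using that Xh[OF InlI, of i k] by (simp add: mu_def)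
    show "etaG i * Gc P i (X k) > 0" if "etaG i > 0" for i k
      using that Xc[OF InrI[OF InlI], of i k] by (simp add: etaG_def split: if_splits)
    show "etaH i * Hc P i (X k) < 0" if "etaH i \<noteq> 0" for i k
    proof (cases "i \<in> I_zm P x")
      case True
      then have "etaH i = l (Inr (Inr i))"
        using disj[OF True] by (simp add: etaH_def)
      then show ?thesis
        using that l[OF InrI[OF InrI[OF True]]] Xc[OF InrI[OF InrI[OF True]], of k]
        by (simp add: mult_less_0_iff)
    next
      case False
      then have i: "i \<in> I_zp P x \<union> I_zz P x" and "etaH i = - m (Inr i)"
        using that by (auto simp: etaH_def split: if_splits)
      then show ?thesis
        using that Xh[OF InrI[OF i], of k] by simp
    qed
  qed
  from t show ?thesis
  proof
    assume "t = 1"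
    with stat sign seq xf show ?thesis
      unfolding enhanced_M_stationary_def by auto
  next
    assume t0: "t = 0 \<and> ((\<exists>j\<in>?J. l j \<noteq> 0) \<or> (\<exists>i\<in>?E. m i \<noteq> 0))"
    have "\<not> multipliers_zero P lam mu etaG etaH"
    proof
      assume "multipliers_zero P lam mu etaG etaH"
      then have lam: "\<And>i. i \<in> {1..numg P} \<Longrightarrow> lam i = 0" and mu: "\<And>i. i \<in> {1..numh P} \<Longrightarrow> mu i = 0"
        and etaG: "\<And>i. i \<in> {1..numv P} \<Longrightarrow> etaG i = 0" and etaH: "\<And>i. i \<in> {1..numv P} \<Longrightarrow> etaH i = 0"
        by (auto simp: multipliers_zero_def)
      have "l (Inl i) = 0" if "i \<in> I_g P x" for i
        using lam[of i] sub that by (auto simp: lam_def)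
      moreover have "l (Inr (Inl i)) = 0" if "i \<in> I_pz P x" for i
        using etaG[of i] sub that by (auto simp: etaG_def)
      moreover have "l (Inr (Inr i)) = 0" if "i \<in> I_zm P x" for i
        using etaH[of i] sub that disj[OF that] by (auto simp: etaH_def)
      moreover have "m (Inl i) = 0" if "i \<in> {1..numh P}" for i
        using mu[OF that] by (simp add: mu_def)
      moreover have "m (Inr i) = 0" if "i \<in> I_zp P x \<union> I_zz P x" for i
        using etaH[of i] sub(4) that disj[of i] by (auto simp: etaH_def split: if_splits)
      ultimately show False
        using t0 by auto
    qed
    with t0 stat sign seq assms(3) show ?thesis
      unfolding generalized_quasinormality_def by auto
  qed
qed

end
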